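(* (i) Every normalized goods instance with two agents and additive valuations admits an allocation that is both EFX and EQX. (ii) There exists a normalized chores instance with two agents and additive valuations that admits no allocation that is both EFX and EQX.
   Context: An instance consists of agents $N=\{1,\dots,n\}$, a finite set $M$ of indivisible items, and for each agent $i$ an additive valuation $v_i:2^M\to\mathbb{R}$, i.e. $v_i(\emptyset)=0$ and $v_i(S)=\sum_{o\in S}v_i(o)$. It is a goods instance if $v_i(o)\ge0$ for all $i,o$, and a chores instance if $v_i(o)\le0$ for all $i,o$. It is normalized if $v_i(M)=v_j(M)$ for all $i,j\in N$. An allocation $A=(A_1,\dots,A_n)$ is a partition of $M$ into $n$ pairwise disjoint, possibly empty bundles with union $M$. For goods: $A$ is EFX if for all $i,j\in N$ with $A_j\neq\emptyset$ and every $g\in A_j$, $v_i(A_i)\ge v_i(A_j\setminus\{g\})$; $A$ is EQX if for all $i,j\in N$ with $A_j\ne\emptyset$ and every $g\in A_j$, $v_i(A_i)\ge v_j(A_j\setminus\{g\})$. For chores: $A$ is EFX if for all $i,j\in N$ with $A_i\ne\emptyset$ and every $c\in A_i$, $v_i(A_i\setminus\{c\})\ge v_i(A_j)$; $A$ is EQX if for all $i,j\in N$ with $A_i\neq\emptyset$ and every $c\in A_i$, $v_i(A_i\setminus\{c\})\ge v_j(A_j)$. In all cases zero-valued items are included among the removable items. *)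

theory Defs
  imports Complex_Main "HOL-Library.Disjoint_Sets"
begin

definition additive_valuation :: "'a set \<Rightarrow> ('a set \<Rightarrow> real) \<Rightarrow> bool" where
  "additive_valuation M u \<longleftrightarrow> u {} = 0 \<and> (\<forall>S\<subseteq>M. u S = (\<Sum>x\<in>S. u {x}))"

text \<open>The agents are \<open>{1..n}\<close>, and \<open>v i S\<close> is the value of the bundle \<open>S\<close> for agent \<open>i\<close>.
  Values of \<open>v\<close> and of an allocation \<open>A\<close> outside \<open>{1..n}\<close> are irrelevant,
  as are values of \<open>v i\<close> on sets that are not subsets of \<open>M\<close>.\<close>

definition allocation_instance :: "nat \<Rightarrow> 'a set \<Rightarrow> (nat \<Rightarrow> 'a set \<Rightarrow> real) \<Rightarrow> bool" where
  "allocation_instance n M v \<longleftrightarrow> finite M \<and> (\<forall>i\<in>{1..n}. additive_valuation M (v i))"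

definition goods_instance :: "nat \<Rightarrow> 'a set \<Rightarrow> (nat \<Rightarrow> 'a set \<Rightarrow> real) \<Rightarrow> bool" where
  "goods_instance n M v \<longleftrightarrow>
     allocation_instance n M v \<and> (\<forall>i\<in>{1..n}. \<forall>x\<in>M. v i {x} \<ge> 0)"

definition chores_instance :: "nat \<Rightarrow> 'a set \<Rightarrow> (nat \<Rightarrow> 'a set \<Rightarrow> real) \<Rightarrow> bool" where
  "chores_instance n M v \<longleftrightarrow>
     allocation_instance n M v \<and> (\<forall>i\<in>{1..n}. \<forall>x\<in>M. v i {x} \<le> 0)"

definition normalized_instance :: "nat \<Rightarrow> 'a set \<Rightarrow> (nat \<Rightarrow> 'a set \<Rightarrow> real) \<Rightarrow> bool" where
  "normalized_instance n M v \<longleftrightarrow> (\<forall>i\<in>{1..n}. \<forall>j\<in>{1..n}. v i M = v j M)"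

text \<open>Bundles may be empty, so \<open>partition_on\<close> is not suitable.\<close>

definition allocation :: "nat \<Rightarrow> 'a set \<Rightarrow> (nat \<Rightarrow> 'a set) \<Rightarrow> bool" where
  "allocation n M A \<longleftrightarrow> disjoint_family_on A {1..n} \<and> (\<Union>i\<in>{1..n}. A i) = M"

text \<open>Below, the requirement that the bundle losing an item be nonempty is implicit
  in the quantification over its items. Zero-valued items are also removable.\<close>

definition goods_EFX :: "nat \<Rightarrow> (nat \<Rightarrow> 'a set \<Rightarrow> real) \<Rightarrow> (nat \<Rightarrow> 'a set) \<Rightarrow> bool" where
  "goods_EFX n v A \<longleftrightarrow>
     (\<forall>i\<in>{1..n}. \<forall>j\<in>{1..n}. \<forall>g\<in>A j. v i (A i) \<ge> v i (A j - {g}))"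

definition goods_EQX :: "nat \<Rightarrow> (nat \<Rightarrow> 'a set \<Rightarrow> real) \<Rightarrow> (nat \<Rightarrow> 'a set) \<Rightarrow> bool" where
  "goods_EQX n v A \<longleftrightarrow>
     (\<forall>i\<in>{1..n}. \<forall>j\<in>{1..n}. \<forall>g\<in>A j. v i (A i) \<ge> v j (A j - {g}))"

definition chores_EFX :: "nat \<Rightarrow> (nat \<Rightarrow> 'a set \<Rightarrow> real) \<Rightarrow> (nat \<Rightarrow> 'a set) \<Rightarrow> bool" where
  "chores_EFX n v A \<longleftrightarrow>
     (\<forall>i\<in>{1..n}. \<forall>j\<in>{1..n}. \<forall>c\<in>A i. v i (A i - {c}) \<ge> v i (A j))"

definition chores_EQX :: "nat \<Rightarrow> (nat \<Rightarrow> 'a set \<Rightarrow> real) \<Rightarrow> (nat \<Rightarrow> 'a set) \<Rightarrow> bool" where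
  "chores_EQX n v A \<longleftrightarrow>
     (\<forall>i\<in>{1..n}. \<forall>j\<in>{1..n}. \<forall>c\<in>A i. v i (A i - {c}) \<ge> v j (A j))"

end

theory Submission
  imports Defs
begin

text \<open>For goods, call one agent poor if her value is at most that of the other, and choose an
  allocation with a poor agent \<open>p\<close> that lexicographically maximizes her value and then the
  size of her bundle. If removing a good from the other bundle still left the other agent \<open>q\<close>
  richer than \<open>p\<close>, then handing this good to \<open>p\<close> would improve the choice; hence the allocation
  is EQX. If \<open>p\<close> gets less than half of the common total, then \<open>q\<close> gets at least half, since
  otherwise exchanging the bundles would make both agents richer than \<open>p\<close>; and if \<open>p\<close> envied
  \<open>q\<close> after the removal of a good \<open>g\<close>, then moving \<open>g\<close> to \<open>p\<close> and exchanging the bundles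
  afterwards would do so, because by EQX \<open>q\<close> values her bundle without \<open>g\<close> at less than half.

  For chores, three items with costs \<open>0, 1, 2\<close> and \<open>2, 1, 0\<close> form a counterexample.\<close>

lemma additive_valuation_Diff:
  assumes "additive_valuation M u" "finite M" "S \<subseteq> M"
  shows "u (M - S) = u M - u S"
proof -
  have "u M = (\<Sum>x\<in>M. u {x})" "u S = (\<Sum>x\<in>S. u {x})" "u (M - S) = (\<Sum>x\<in>M - S. u {x})"
    using assms unfolding additive_valuation_def by blast+
  then show ?thesis
    using assms by (simp add: sum_diff)
qed

lemma additive_valuation_remove:
  assumes "additive_valuation M u" "finite M" "S \<subseteq> M" "g \<in> S"
  shows "u (S - {g}) = u S - u {g}"
proof (rule additive_valuation_Diff)
  show "additive_valuation S u"
    using assms(1,3) unfolding additive_valuation_def by blast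
qed (use assms finite_subset in auto)

lemma additive_valuation_insert:
  assumes "additive_valuation M u" "finite M" "S \<subseteq> M" "g \<in> M - S"
  shows "u (insert g S) = u S + u {g}"
  using additive_valuation_remove[of M u "insert g S" g] assms by simp

text \<open>The maximizers of \<open>f\<close> form a finite nonempty set, over which
  \<open>h\<close> can be maximized in turn.\<close>

lemma exists_lex_max:
  fixes f :: "'b \<Rightarrow> real" and h :: "'b \<Rightarrow> nat"
  assumes "finite C" "C \<noteq> {}"
  obtains c where "c \<in> C" "\<And>d. d \<in> C \<Longrightarrow> f d < f c \<or> (f d = f c \<and> h d \<le> h c)"
proof -
  define D where "D = {c \<in> C. f c = Max (f ` C)}"
  have "Max (f ` C) \<in> f ` C"
    using assms by simp
  then obtain c where "c \<in> C" "f c = Max (f ` C)"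
    by (metis imageE)
  then have D: "finite D" "D \<noteq> {}"
    using assms(1) by (auto simp: D_def)
  then have "Max (h ` D) \<in> h ` D"
    by simp
  then obtain c where c: "c \<in> D" "h c = Max (h ` D)"
    by (metis imageE)
  have "f d < f c \<or> (f d = f c \<and> h d \<le> h c)" if "d \<in> C" for d
  proof (cases "d \<in> D")
    case True
    then show ?thesis
      using c D by (simp add: D_def)
  next
    case False
    have "f d \<le> Max (f ` C)"
      using assms that by simp
    then show ?thesis
      using False c that by (auto simp: D_def)
  qed
  then show thesis
    using that c by (auto simp: D_def)
qed

lemma goods_two_agents:
  fixes v :: "nat \<Rightarrow> 'a set \<Rightarrow> real"
  assumes "goods_instance 2 M v" "normalized_instance 2 M v"
  shows "\<exists>A. allocation 2 M A \<and> goods_EFX 2 v A \<and> goods_EQX 2 v A"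
proof -
  have N: "{1..2::nat} = {1, 2}"
    by auto
  have fin: "finite M" and add: "\<And>i. i \<in> {1, 2} \<Longrightarrow> additive_valuation M (v i)"
    and pos: "\<And>i x. i \<in> {1, 2} \<Longrightarrow> x \<in> M \<Longrightarrow> 0 \<le> v i {x}"
    using assms(1) by (auto simp: goods_instance_def allocation_instance_def N)
  note Diff = additive_valuation_Diff[OF add fin]
    and remove = additive_valuation_remove[OF add fin]
    and insert = additive_valuation_insert[OF add fin]
  define T where "T = v 1 M"
  have T: "v i M = T" if "i \<in> {1, 2}" for i
    using assms(2) that by (auto simp: normalized_instance_def N T_def)
  define other :: "nat \<Rightarrow> nat" where "other i = 3 - i" for i
  have other: "other i \<in> {1, 2}" "other (other i) = i" "other i \<noteq> i" if "i \<in> {1, 2}" for i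
    using that by (auto simp: other_def)
  have N_other: "{1..2} = {i, other i}" if "i \<in> {1, 2}" for i
    using that by (auto simp: other_def)
  \<comment> \<open>A pair encodes the allocation that gives \<open>S\<close> to the poor agent
    \<open>i\<close> and the rest to the other.\<close>
  define C where "C = {(i, S). i \<in> {1, 2} \<and> S \<subseteq> M \<and> v i S \<le> v (other i) (M - S)}"
  have "C \<subseteq> {1, 2} \<times> Pow M"
    by (auto simp: C_def)
  then have "finite C"
    using fin finite_subset by (metis finite.simps finite_Pow_iff finite_SigmaI)
  moreover have "C \<noteq> {}"
  proof -
    have "v 2 (M - {}) = v 2 M - v 2 {}"
      by (rule Diff) auto
    \<comment> \<open>When agent 2 receives everything, one of the two agents is poor.\<close>
    then have "(1, {}) \<in> C \<or> (2, M) \<in> C"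
      by (auto simp: C_def other_def)
    then show ?thesis
      by auto
  qed
  ultimately obtain c where c: "c \<in> C"
      "\<And>d. d \<in> C \<Longrightarrow> v (fst d) (snd d) < v (fst c) (snd c) \<or>
        (v (fst d) (snd d) = v (fst c) (snd c) \<and> card (snd d) \<le> card (snd c))"
    using exists_lex_max[of C "\<lambda>d. v (fst d) (snd d)" "\<lambda>d. card (snd d)"] by blast
  obtain p S where pS: "c = (p, S)"
    by (cases c)
  define q where "q = other p"
  have p: "p \<in> {1, 2}" and S: "S \<subseteq> M" and poor: "v p S \<le> v q (M - S)"
    using c(1) by (auto simp: C_def pS q_def)
  have q: "q \<in> {1, 2}" "other q = p" "p \<noteq> q" and pq: "{1..2} = {p, q}"
    using other[OF p] N_other[OF p] by (auto simp: q_def)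
  have max: "v i U < v p S \<or> (v i U = v p S \<and> card U \<le> card S)"
    if "i \<in> {1, 2}" "U \<subseteq> M" "v i U \<le> v (other i) (M - U)" for i U
    using c(2)[of "(i, U)"] that by (simp add: C_def pS)
  \<comment> \<open>Whichever agent is poor when \<open>p\<close> gets \<open>U\<close> and
    \<open>q\<close> the rest, she yields a pair in \<open>C\<close>.\<close>
  have no_improvement: "v p U \<le> v p S \<or> v q (M - U) \<le> v p S" if "U \<subseteq> M" for U
  proof (cases "v p U \<le> v q (M - U)")
    case True
    then show ?thesis
      using max[of p U] p that by (auto simp: q_def)
  next
    case False
    moreover have "M - (M - U) = U"
      using that by auto
    ultimately show ?thesis
      using max[of q "M - U"] q by auto
  qed
  have EQX: "v q (M - S - {g}) \<le> v p S" if g: "g \<in> M - S" for g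
  proof (rule ccontr)
    assume less: "\<not> ?thesis"
    have "M - insert g S = M - S - {g}"
      by auto
    moreover have "v p (insert g S) = v p S + v p {g}" "0 \<le> v p {g}"
      using insert[OF p S g] pos[OF p] g by auto
    \<comment> \<open>This settles the case \<open>v p {g} = 0\<close>, where the values tie and
      only the tie-break on size is violated.\<close>
    moreover have "card (insert g S) = Suc (card S)"
      using g finite_subset[OF S fin] by simp
    ultimately show False
      using less no_improvement[of "insert g S"] max[of p "insert g S"] S g p
      by (auto simp: q_def)
  qed
  have swap: "T - v p S \<le> v p S \<or> T - v q (M - S) \<le> v p S"
    using no_improvement[of "M - S"] Diff[OF p S] Diff[OF q(1), of "M - S"] S T p q
    by (auto simp: double_diff)
  have EFX_p: "v p (M - S - {g}) \<le> v p S" if g: "g \<in> M - S" for g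
  proof (rule ccontr)
    assume less: "\<not> ?thesis"
    have "M - (M - S - {g}) = insert g S"
      using S g by auto
    moreover have "v q (M - (M - S - {g})) = T - v q (M - S - {g})"
      using Diff[OF q(1), of "M - S - {g}"] T q by auto
    moreover have "v p (M - S - {g}) \<le> v p (M - S)"
      using remove[OF p _ g] pos[OF p] g by auto
    \<comment> \<open>By \<open>EQX\<close>, \<open>q\<close> values \<open>insert g S\<close> at no
      less than \<open>T - v p S\<close>. So the second alternative of \<open>no_improvement\<close>
      forces \<open>v p (M - S) \<le> v p S\<close>, against \<open>less\<close>.\<close>
    ultimately show False
      using less no_improvement[of "M - S - {g}"] EQX[OF g] Diff[OF p S] T[OF p] by auto
  qed
  \<comment> \<open>With \<open>poor\<close>, either case of \<open>swap\<close> gives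
    \<open>T \<le> 2 * v q (M - S)\<close>, so \<open>q\<close> does not even envy all of
    \<open>S\<close>.\<close>
  have EFX_q: "v q (S - {g}) \<le> v q (M - S)" if g: "g \<in> S" for g
    using remove[OF q(1) S g] pos[OF q(1)] Diff[OF q(1) S] T[OF q(1)] g S swap poor by force
  have mono: "v i (U - {g}) \<le> v i U" if "i \<in> {1, 2}" "U \<subseteq> M" "g \<in> U" for i U g
    using remove[OF that] pos[OF that(1)] that by auto
  define A where "A = (\<lambda>i. if i = p then S else M - S)"
  have A: "A p = S" "A q = M - S"
    using q by (auto simp: A_def)
  have "allocation 2 M A"
    unfolding allocation_def pq using A S q by (auto simp: disjoint_family_on_def)
  moreover have "goods_EFX 2 v A"
    unfolding goods_EFX_def pq using A S p q EFX_p EFX_q mono by auto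
  moreover have "goods_EQX 2 v A"
  proof -
    have "v p (S - {g}) \<le> v q (M - S)" if "g \<in> S" for g
      using mono[OF p S that] poor by linarith
    then show ?thesis
      unfolding goods_EQX_def pq using A S p q EQX mono by auto
  qed
  ultimately show ?thesis
    by blast
qed

lemma chores_two_agents_counterexample:
  "\<exists>(M :: nat set) (v :: nat \<Rightarrow> nat set \<Rightarrow> real).
      chores_instance 2 M v \<and> normalized_instance 2 M v \<and>
      \<not> (\<exists>A. allocation 2 M A \<and> chores_EFX 2 v A \<and> chores_EQX 2 v A)"
proof -
  define M :: "nat set" where "M = {0, 1, 2}"
  define v :: "nat \<Rightarrow> nat set \<Rightarrow> real"
    where "v i S = (if i = 1 then (\<Sum>k\<in>S. - real k) else (\<Sum>k\<in>S. real k - 2))" for i S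
  have N: "{1..2::nat} = {1, 2}"
    by auto
  have "chores_instance 2 M v" "normalized_instance 2 M v"
    by (auto simp: chores_instance_def normalized_instance_def allocation_instance_def
        additive_valuation_def N M_def v_def)
  moreover have False
    if "allocation 2 M A" and EFX: "chores_EFX 2 v A" and EQX: "chores_EQX 2 v A" for A
  proof -
    have A2: "A 2 = M - A 1" and "A 1 \<in> Pow M"
      using that(1) unfolding allocation_def N by (auto simp: disjoint_family_on_def)
    then have "A 1 \<in> {{0, 1, 2}, {0, 1}, {0, 2}, {0}, {1, 2}, {1}, {2}, {}}"
      by (simp add: M_def Pow_insert)
    moreover have "\<forall>c\<in>A 1. v 1 (A 2) \<le> v 1 (A 1 - {c}) \<and> v 2 (A 2) \<le> v 1 (A 1 - {c})"
      "\<forall>c\<in>A 2. v 2 (A 1) \<le> v 2 (A 2 - {c}) \<and> v 1 (A 1) \<le> v 2 (A 2 - {c})"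
      using EFX EQX unfolding chores_EFX_def chores_EQX_def N by blast+
    \<comment> \<open>If both agents hold their own zero-cost item, the holder of item 1 violates
      EQX by dropping that item. Each of the other six allocations violates EFX.\<close>
    ultimately show False
      unfolding A2 M_def by (elim insertE) (simp_all add: v_def insert_Diff_if)
  qed
  ultimately show ?thesis
    by blast
qed

theorem proposition2:
  "(\<forall>(M :: 'a set) (v :: nat \<Rightarrow> 'a set \<Rightarrow> real).
      goods_instance 2 M v \<and> normalized_instance 2 M v \<longrightarrow>
      (\<exists>A. allocation 2 M A \<and> goods_EFX 2 v A \<and> goods_EQX 2 v A)) \<and>
   (\<exists>(M :: nat set) (v :: nat \<Rightarrow> nat set \<Rightarrow> real).
      chores_instance 2 M v \<and> normalized_instance 2 M v \<and>
      \<not> (\<exists>A. allocation 2 M A \<and> chores_EFX 2 v A \<and> chores_EQX 2 v A))"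
  using goods_two_agents chores_two_agents_counterexample by blast

end
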